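(* Let $A$ be a Banach algebra and let $X$ be a Banach $A$-bimodule. Then the module extension Banach algebra $A\oplus_1X$ is $\Delta$-weak character amenable if and only if $A$ is $\Delta$-weak character amenable.
   Context: For a Banach algebra $A$, $\Delta(A)$ denotes the set of all nonzero characters (nonzero multiplicative linear functionals) on $A$. For $f\in A^*$ and $a\in A$, the functional $f.a\in A^*$ is defined by $(f.a)(b)=f(ab)$ for $b\in A$. For $\varphi\in\Delta(A)\cup\{0\}$, $A$ is called $\Delta$-weak $\varphi$-amenable if there exists $m\in A^{**}$ such that (1) $m(\varphi)=0$; and (2) $m(\psi.a)=\psi(a)$ for all $a\in A$ and all $\psi\in\Delta(A)\setminus\{\varphi\}$. $A$ is called $\Delta$-weak character amenable if it is $\Delta$-weak $\varphi$-amenable for every $\varphi\in\Delta(A)\cup\{0\}$. For a Banach algebra $A$ and a Banach $A$-bimodule $X$, the module extension Banach algebra $A\oplus_1X$ is the $\ell^1$-direct sum of $A$ and $X$ (norm $\|(a,x)\|=\|a\|+\|x\|$) with the product $(a,x)(a',x')=(aa',\,a.x'+x.a')$ for $a,a'\in A$, $x,x'\in X$. *)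

theory Defs
  imports "HOL-Analysis.Analysis"
begin

section \<open>Complex Banach spaces\<close>

text \<open>The type class \<open>banach\<close> of the library is about real scalars. Multiplication by a complex
  scalar is added so that it extends the real one; \<open>1 *\<^sub>C x = x\<close> follows from
  \<open>scaleR_scaleC\<close>.\<close>

class complex_normed_vector = real_normed_vector +
  fixes scaleC :: "complex \<Rightarrow> 'a \<Rightarrow> 'a"  (infixr \<open>*\<^sub>C\<close> 75)
  assumes scaleC_add_right: "c *\<^sub>C (x + y) = c *\<^sub>C x + c *\<^sub>C y"
    and scaleC_add_left: "(c + d) *\<^sub>C x = c *\<^sub>C x + d *\<^sub>C x"
    and scaleC_scaleC: "c *\<^sub>C (d *\<^sub>C x) = (c * d) *\<^sub>C x"
    and scaleR_scaleC: "r *\<^sub>R x = complex_of_real r *\<^sub>C x"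
    and norm_scaleC: "norm (c *\<^sub>C x) = cmod c * norm x"

class complex_banach = complex_normed_vector + banach

section \<open>The dual space\<close>

text \<open>\<open>'a cdual\<close> is the space of continuous complex-linear functionals on \<open>'a\<close> with the
  operator norm. The bidual is \<open>'a cdual cdual\<close>.\<close>

typedef (overloaded) 'a cdual =
  "{f :: 'a::complex_normed_vector \<Rightarrow> complex. bounded_linear f \<and> (\<forall>c x. f (c *\<^sub>C x) = c * f x)}"
  morphisms cdual_apply Abs_cdual
  by (rule exI[of _ "\<lambda>_. 0"]) (simp add: bounded_linear_zero)

setup_lifting type_definition_cdual

lemma bounded_linear_cdual_apply: "bounded_linear (cdual_apply f)"
  using cdual_apply[of f] by simp

lemma cdual_apply_scaleC: "cdual_apply f (c *\<^sub>C x) = c * cdual_apply f x"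
  using cdual_apply[of f] by simp

lemma cdual_eqI: "(\<And>x. cdual_apply f x = cdual_apply g x) \<Longrightarrow> f = g"
  by (metis cdual_apply_inject ext)

instantiation cdual :: (complex_normed_vector) complex_normed_vector
begin

lift_definition zero_cdual :: "'a cdual" is "\<lambda>_. 0"
  by (simp add: bounded_linear_zero)

lift_definition plus_cdual :: "'a cdual \<Rightarrow> 'a cdual \<Rightarrow> 'a cdual" is "\<lambda>f g x. f x + g x"
  by (auto intro: bounded_linear_add simp: algebra_simps)

lift_definition minus_cdual :: "'a cdual \<Rightarrow> 'a cdual \<Rightarrow> 'a cdual" is "\<lambda>f g x. f x - g x"
  by (auto intro: bounded_linear_sub simp: algebra_simps)

lift_definition uminus_cdual :: "'a cdual \<Rightarrow> 'a cdual" is "\<lambda>f x. - f x"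
  by (auto intro: bounded_linear_minus)

lift_definition scaleR_cdual :: "real \<Rightarrow> 'a cdual \<Rightarrow> 'a cdual" is "\<lambda>r f x. r *\<^sub>R f x"
  by (auto intro: bounded_linear_const_scaleR)

lift_definition scaleC_cdual :: "complex \<Rightarrow> 'a cdual \<Rightarrow> 'a cdual" is "\<lambda>c f x. c * f x"
  by (auto intro: bounded_linear_const_mult)

lift_definition norm_cdual :: "'a cdual \<Rightarrow> real" is onorm .

definition dist_cdual :: "'a cdual \<Rightarrow> 'a cdual \<Rightarrow> real"
  where "dist_cdual f g = norm (f - g)"

definition sgn_cdual :: "'a cdual \<Rightarrow> 'a cdual"
  where "sgn_cdual f = scaleR (inverse (norm f)) f"

definition uniformity_cdual :: "('a cdual \<times> 'a cdual) filter"
  where "uniformity_cdual = (INF e\<in>{0<..}. principal {(f, g). dist f g < e})"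

definition open_cdual :: "'a cdual set \<Rightarrow> bool"
  where "open_cdual U = (\<forall>x\<in>U. \<forall>\<^sub>F (x', y) in uniformity. x' = x \<longrightarrow> y \<in> U)"

instance
proof
  fix f g h :: "'a cdual" and r s :: real and c d :: complex
  show "f + g + h = f + (g + h)" "f + g = g + f" "0 + f = f" "- f + f = 0" "f - g = f + - g"
    by (transfer; simp add: fun_eq_iff algebra_simps)+
  show "r *\<^sub>R (f + g) = r *\<^sub>R f + r *\<^sub>R g" "(r + s) *\<^sub>R f = r *\<^sub>R f + s *\<^sub>R f"
    "r *\<^sub>R s *\<^sub>R f = (r * s) *\<^sub>R f" "1 *\<^sub>R f = f"
    by (transfer; simp add: fun_eq_iff algebra_simps)+
  show "c *\<^sub>C (f + g) = c *\<^sub>C f + c *\<^sub>C g" "(c + d) *\<^sub>C f = c *\<^sub>C f + d *\<^sub>C f"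
    "c *\<^sub>C d *\<^sub>C f = (c * d) *\<^sub>C f" "r *\<^sub>R f = complex_of_real r *\<^sub>C f"
    by (transfer; simp add: fun_eq_iff algebra_simps scaleR_conv_of_real)+
  show "norm (c *\<^sub>C f) = cmod c * norm f"
  proof transfer
    fix c and f :: "'a \<Rightarrow> complex"
    assume f: "bounded_linear f \<and> (\<forall>c x. f (c *\<^sub>C x) = c * f x)"
    have "onorm (\<lambda>x. c * f x) = (SUP x. cmod c * (cmod (f x) / norm x))"
      by (simp add: onorm_def norm_mult)
    also have "\<dots> = onorm (\<lambda>x. cmod c *\<^sub>R f x)"
      by (simp add: onorm_def)
    also have "\<dots> = cmod c * onorm f"
      using f by (simp only: onorm_scaleR abs_norm_cancel)
    finally show "onorm (\<lambda>x. c * f x) = cmod c * onorm f" .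
  qed
  show "dist f g = norm (f - g)" by (simp add: dist_cdual_def)
  show "sgn f = scaleR (inverse (norm f)) f" by (simp add: sgn_cdual_def)
  show "(norm f = 0) = (f = 0)" by transfer (auto simp: onorm_eq_0 fun_eq_iff)
  show "norm (f + g) \<le> norm f + norm g" by transfer (auto intro: onorm_triangle)
  show "norm (r *\<^sub>R f) = \<bar>r\<bar> * norm f" by transfer (auto intro: onorm_scaleR)
  show "(uniformity :: ('a cdual \<times> 'a cdual) filter)
      = (INF e\<in>{0<..}. principal {(f, g). dist f g < e})"
    by (rule uniformity_cdual_def)
  fix U :: "'a cdual set"
  show "open U = (\<forall>x\<in>U. \<forall>\<^sub>F (x', y) in uniformity. x' = x \<longrightarrow> y \<in> U)"
    by (rule open_cdual_def)
qed

end

section \<open>Banach algebras and characters\<close>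

text \<open>The product is an explicit parameter and not a type class operation, because the product of
  a module extension depends on the two actions.\<close>

locale banach_algebra =
  fixes mul :: "'a::complex_banach \<Rightarrow> 'a \<Rightarrow> 'a"
  assumes mul_assoc: "mul (mul a b) c = mul a (mul b c)"
    and mul_add_left: "mul (a + b) c = mul a c + mul b c"
    and mul_add_right: "mul a (b + c) = mul a b + mul a c"
    and mul_scaleC_left: "mul (z *\<^sub>C a) b = z *\<^sub>C mul a b"
    and mul_scaleC_right: "mul a (z *\<^sub>C b) = z *\<^sub>C mul a b"
    and norm_mul_le: "norm (mul a b) \<le> norm a * norm b"
begin

lemma bounded_bilinear_mul: "bounded_bilinear mul"
  by (unfold_locales)
     (auto simp: mul_add_left mul_add_right scaleR_scaleC mul_scaleC_left mul_scaleC_right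
       norm_mul_le intro!: exI[of _ 1])

end

text \<open>Elements of \<open>\<Delta>(A)\<close> are taken in the dual space. This is no restriction: by
  \<open>multiplicative_functional_in_cdual\<close> every multiplicative linear functional is continuous.\<close>

definition characters :: "('a::complex_banach \<Rightarrow> 'a \<Rightarrow> 'a) \<Rightarrow> 'a cdual set"  (\<open>\<Delta>\<close>)
  where "\<Delta> mul =
    {\<phi>. \<phi> \<noteq> 0 \<and> (\<forall>a b. cdual_apply \<phi> (mul a b) = cdual_apply \<phi> a * cdual_apply \<phi> b)}"

lemma multiplicative_functional_in_cdual:
  fixes mul :: "'a::complex_banach \<Rightarrow> 'a \<Rightarrow> 'a" and \<phi> :: "'a \<Rightarrow> complex"
  assumes mul: "bounded_bilinear mul"
    and add: "\<And>a b. \<phi> (a + b) = \<phi> a + \<phi> b"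
    and scale: "\<And>c a. \<phi> (c *\<^sub>C a) = c * \<phi> a"
    and multiplicative: "\<And>a b. \<phi> (mul a b) = \<phi> a * \<phi> b"
  shows "\<exists>f. cdual_apply f = \<phi>"
proof -
  interpret bounded_bilinear mul by (rule mul)
  obtain K where K: "0 < K" "\<And>a b. norm (mul a b) \<le> norm a * norm b * K"
    using pos_bounded by blast
  have bound: "cmod (\<phi> a) \<le> norm a * K" for a
  proof (rule ccontr)
    assume *: "\<not> cmod (\<phi> a) \<le> norm a * K"
    then have nz: "\<phi> a \<noteq> 0"
      using mult_nonneg_nonneg[of "norm a" K] K(1) by auto
    define u where "u = inverse (\<phi> a) *\<^sub>C a"
    have u1: "\<phi> u = 1" using nz by (simp add: u_def scale)
    have uK: "norm u * K < 1"
      using * nz by (simp add: u_def norm_scaleC norm_inverse norm_divide divide_simps mult.commute[of K] not_le)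
    have "\<exists>!b. u + mul u b = b"
    proof (rule banach_fix_type)
      show "\<forall>x y. dist (u + mul u x) (u + mul u y) \<le> (norm u * K) * dist x y"
        using K(2)[of u "_ - _"] by (simp add: dist_norm diff_right[symmetric] mult.assoc mult.commute[of K])
    qed (use uK K(1) in auto)
    then obtain b where "u + mul u b = b" by blast
    then have "\<phi> b = 1 + \<phi> b" using add multiplicative u1 by (metis mult_1)
    then show False by simp
  qed
  have "bounded_linear \<phi>"
    by (rule bounded_linear_intro[where K = K])
       (simp_all add: add scale scaleR_scaleC scaleR_conv_of_real bound)
  then show ?thesis
    using Abs_cdual_inverse[of \<phi>] scale by blast
qed

text \<open>The functional \<open>f.a\<close>, given by \<open>(f.a)(b) = f(ab)\<close>.\<close>

definition dual_act :: "('a::complex_banach \<Rightarrow> 'a \<Rightarrow> 'a) \<Rightarrow> 'a cdual \<Rightarrow> 'a \<Rightarrow> 'a cdual"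
  where "dual_act mul f a = Abs_cdual (\<lambda>b. cdual_apply f (mul a b))"

lemma dual_act_apply:
  assumes "bounded_bilinear mul" and "\<And>z b. mul a (z *\<^sub>C b) = z *\<^sub>C mul a b"
  shows "cdual_apply (dual_act mul f a) b = cdual_apply f (mul a b)"
proof -
  have "bounded_linear (\<lambda>b. cdual_apply f (mul a b))"
    by (intro bounded_linear_compose[OF bounded_linear_cdual_apply]
        bounded_bilinear.bounded_linear_right assms)
  then show ?thesis
    by (simp add: dual_act_def Abs_cdual_inverse assms(2) cdual_apply_scaleC)
qed

section \<open>\<open>\<Delta>\<close>-weak character amenability\<close>

definition Delta_weak_amenable_at ::
    "('a::complex_banach \<Rightarrow> 'a \<Rightarrow> 'a) \<Rightarrow> 'a cdual \<Rightarrow> bool"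
  where "Delta_weak_amenable_at mul \<phi> \<longleftrightarrow>
    (\<exists>m :: 'a cdual cdual. cdual_apply m \<phi> = 0 \<and>
      (\<forall>a. \<forall>\<psi> \<in> \<Delta> mul - {\<phi>}. cdual_apply m (dual_act mul \<psi> a) = cdual_apply \<psi> a))"

definition Delta_weak_character_amenable ::
    "('a::complex_banach \<Rightarrow> 'a \<Rightarrow> 'a) \<Rightarrow> bool"
  where "Delta_weak_character_amenable mul \<longleftrightarrow>
    (\<forall>\<phi> \<in> \<Delta> mul \<union> {0}. Delta_weak_amenable_at mul \<phi>)"

section \<open>Banach bimodules\<close>

text \<open>The actions are jointly continuous: \<open>\<parallel>a.x\<parallel> \<le> K \<parallel>a\<parallel> \<parallel>x\<parallel>\<close> and
  \<open>\<parallel>x.a\<parallel> \<le> K \<parallel>a\<parallel> \<parallel>x\<parallel>\<close> for some constant \<open>K\<close>. The convention \<open>K = 1\<close>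
  is a special case, in which the \<open>\<ell>\<^sup>1\<close>-norm of a module extension is submultiplicative
  (\<open>modext_banach_algebra\<close>); in general its product is associative and jointly continuous
  (\<open>modext_assoc\<close>, \<open>bounded_bilinear_modext\<close>).\<close>

locale banach_bimodule = banach_algebra mul
  for mul :: "'a::complex_banach \<Rightarrow> 'a \<Rightarrow> 'a" +
  fixes lact :: "'a \<Rightarrow> 'x::complex_banach \<Rightarrow> 'x"
    and ract :: "'x \<Rightarrow> 'a \<Rightarrow> 'x"
  assumes bounded_bilinear_lact: "bounded_bilinear lact"
    and bounded_bilinear_ract: "bounded_bilinear ract"
    and lact_scaleC_left: "lact (z *\<^sub>C a) x = z *\<^sub>C lact a x"
    and lact_scaleC_right: "lact a (z *\<^sub>C x) = z *\<^sub>C lact a x"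
    and ract_scaleC_left: "ract (z *\<^sub>C x) a = z *\<^sub>C ract x a"
    and ract_scaleC_right: "ract x (z *\<^sub>C a) = z *\<^sub>C ract x a"
    and lact_lact: "lact a (lact b x) = lact (mul a b) x"
    and ract_ract: "ract (ract x a) b = ract x (mul a b)"
    and lact_ract: "ract (lact a x) b = lact a (ract x b)"

section \<open>The \<open>\<ell>\<^sup>1\<close>-direct sum\<close>

text \<open>A copy of the product type, since \<open>'a \<times> 'b\<close> already carries the Euclidean norm.\<close>

typedef ('a, 'b) l1_sum = "UNIV :: ('a \<times> 'b) set"
  morphisms l1_pair Abs_l1_sum ..

setup_lifting type_definition_l1_sum

lift_definition L1 :: "'a \<Rightarrow> 'b \<Rightarrow> ('a, 'b) l1_sum" is Pair .
lift_definition l1_fst :: "('a, 'b) l1_sum \<Rightarrow> 'a" is fst .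
lift_definition l1_snd :: "('a, 'b) l1_sum \<Rightarrow> 'b" is snd .

lemma l1_fst_L1 [simp]: "l1_fst (L1 a b) = a" by transfer simp
lemma l1_snd_L1 [simp]: "l1_snd (L1 a b) = b" by transfer simp
lemma L1_fst_snd [simp]: "L1 (l1_fst p) (l1_snd p) = p" by transfer simp
lemma l1_sum_eq_iff: "p = q \<longleftrightarrow> l1_fst p = l1_fst q \<and> l1_snd p = l1_snd q"
  by transfer (simp add: prod_eq_iff)

instantiation l1_sum :: (complex_normed_vector, complex_normed_vector) complex_normed_vector
begin

definition zero_l1_sum :: "('a, 'b) l1_sum"
  where "zero_l1_sum = L1 0 0"
definition plus_l1_sum :: "('a, 'b) l1_sum \<Rightarrow> ('a, 'b) l1_sum \<Rightarrow> ('a, 'b) l1_sum"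
  where "p + q = L1 (l1_fst p + l1_fst q) (l1_snd p + l1_snd q)"
definition minus_l1_sum :: "('a, 'b) l1_sum \<Rightarrow> ('a, 'b) l1_sum \<Rightarrow> ('a, 'b) l1_sum"
  where "p - q = L1 (l1_fst p - l1_fst q) (l1_snd p - l1_snd q)"
definition uminus_l1_sum :: "('a, 'b) l1_sum \<Rightarrow> ('a, 'b) l1_sum"
  where "- p = L1 (- l1_fst p) (- l1_snd p)"
definition scaleR_l1_sum :: "real \<Rightarrow> ('a, 'b) l1_sum \<Rightarrow> ('a, 'b) l1_sum"
  where "r *\<^sub>R p = L1 (r *\<^sub>R l1_fst p) (r *\<^sub>R l1_snd p)"
definition scaleC_l1_sum :: "complex \<Rightarrow> ('a, 'b) l1_sum \<Rightarrow> ('a, 'b) l1_sum"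
  where "c *\<^sub>C p = L1 (c *\<^sub>C l1_fst p) (c *\<^sub>C l1_snd p)"
definition norm_l1_sum :: "('a, 'b) l1_sum \<Rightarrow> real"
  where "norm p = norm (l1_fst p) + norm (l1_snd p)"
definition dist_l1_sum :: "('a, 'b) l1_sum \<Rightarrow> ('a, 'b) l1_sum \<Rightarrow> real"
  where "dist_l1_sum p q = norm (p - q)"
definition sgn_l1_sum :: "('a, 'b) l1_sum \<Rightarrow> ('a, 'b) l1_sum"
  where "sgn_l1_sum p = scaleR (inverse (norm p)) p"
definition uniformity_l1_sum :: "(('a, 'b) l1_sum \<times> ('a, 'b) l1_sum) filter"
  where "uniformity_l1_sum = (INF e\<in>{0<..}. principal {(p, q). dist p q < e})"
definition open_l1_sum :: "('a, 'b) l1_sum set \<Rightarrow> bool"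
  where "open_l1_sum U = (\<forall>x\<in>U. \<forall>\<^sub>F (x', y) in uniformity. x' = x \<longrightarrow> y \<in> U)"

lemmas l1_sum_ops = zero_l1_sum_def plus_l1_sum_def minus_l1_sum_def uminus_l1_sum_def
  scaleR_l1_sum_def scaleC_l1_sum_def

instance
proof
  fix p q w :: "('a, 'b) l1_sum" and r s :: real and c d :: complex
  show "p + q + w = p + (q + w)" "p + q = q + p" "0 + p = p" "- p + p = 0" "p - q = p + - q"
    by (simp_all add: l1_sum_ops l1_sum_eq_iff algebra_simps)
  show "r *\<^sub>R (p + q) = r *\<^sub>R p + r *\<^sub>R q" "(r + s) *\<^sub>R p = r *\<^sub>R p + s *\<^sub>R p"
    "r *\<^sub>R s *\<^sub>R p = (r * s) *\<^sub>R p" "1 *\<^sub>R p = p"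
    by (simp_all add: l1_sum_ops l1_sum_eq_iff algebra_simps)
  show "c *\<^sub>C (p + q) = c *\<^sub>C p + c *\<^sub>C q" "(c + d) *\<^sub>C p = c *\<^sub>C p + d *\<^sub>C p"
    "c *\<^sub>C d *\<^sub>C p = (c * d) *\<^sub>C p"
    by (simp_all add: l1_sum_ops l1_sum_eq_iff scaleC_add_left scaleC_add_right scaleC_scaleC)
  show "r *\<^sub>R p = complex_of_real r *\<^sub>C p"
    by (simp add: l1_sum_ops scaleR_scaleC)
  show "norm (c *\<^sub>C p) = cmod c * norm p"
    by (simp add: l1_sum_ops norm_l1_sum_def norm_scaleC distrib_left)
  show "dist p q = norm (p - q)" by (simp add: dist_l1_sum_def)
  show "sgn p = scaleR (inverse (norm p)) p" by (simp add: sgn_l1_sum_def)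
  show "(norm p = 0) = (p = 0)"
    by (simp add: norm_l1_sum_def l1_sum_ops l1_sum_eq_iff add_nonneg_eq_0_iff)
  show "norm (p + q) \<le> norm p + norm q"
    using norm_triangle_ineq[of "l1_fst p" "l1_fst q"] norm_triangle_ineq[of "l1_snd p" "l1_snd q"]
    by (simp add: norm_l1_sum_def l1_sum_ops)
  show "norm (r *\<^sub>R p) = \<bar>r\<bar> * norm p"
    by (simp add: norm_l1_sum_def l1_sum_ops distrib_left)
  show "(uniformity :: (('a, 'b) l1_sum \<times> ('a, 'b) l1_sum) filter)
      = (INF e\<in>{0<..}. principal {(p, q). dist p q < e})"
    by (rule uniformity_l1_sum_def)
  fix U :: "('a, 'b) l1_sum set"
  show "open U = (\<forall>x\<in>U. \<forall>\<^sub>F (x', y) in uniformity. x' = x \<longrightarrow> y \<in> U)"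
    by (rule open_l1_sum_def)
qed

end

lemma dist_l1_sum: "dist p q = dist (l1_fst p) (l1_fst q) + dist (l1_snd p) (l1_snd q)"
  by (simp add: dist_norm norm_l1_sum_def minus_l1_sum_def)

instance l1_sum :: (complex_banach, complex_banach) complex_banach
proof
  fix X :: "nat \<Rightarrow> ('a, 'b) l1_sum"
  assume X: "Cauchy X"
  have "Cauchy (\<lambda>n. l1_fst (X n))" "Cauchy (\<lambda>n. l1_snd (X n))"
    using X unfolding Cauchy_def dist_l1_sum
    by (meson add_le_same_cancel1 zero_le_dist le_less_trans le_add_same_cancel1
        le_add_same_cancel2)+
  then obtain a b where
    "(\<lambda>n. l1_fst (X n)) \<longlonglongrightarrow> a" "(\<lambda>n. l1_snd (X n)) \<longlonglongrightarrow> b"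
    by (auto dest!: Cauchy_convergent simp: convergent_def)
  then have "(\<lambda>n. dist (l1_fst (X n)) a + dist (l1_snd (X n)) b) \<longlonglongrightarrow> 0 + 0"
    by (intro tendsto_add) (simp_all add: tendsto_dist_iff[symmetric])
  then have "X \<longlonglongrightarrow> L1 a b"
    by (subst tendsto_dist_iff) (simp add: dist_l1_sum)
  then show "convergent X" by (rule convergentI)
qed

section \<open>Module extensions\<close>

definition modext_mult ::
    "('a::complex_banach \<Rightarrow> 'a \<Rightarrow> 'a) \<Rightarrow> ('a \<Rightarrow> 'x::complex_banach \<Rightarrow> 'x) \<Rightarrow> ('x \<Rightarrow> 'a \<Rightarrow> 'x)
      \<Rightarrow> ('a, 'x) l1_sum \<Rightarrow> ('a, 'x) l1_sum \<Rightarrow> ('a, 'x) l1_sum"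
  where "modext_mult mul lact ract p q =
    L1 (mul (l1_fst p) (l1_fst q)) (lact (l1_fst p) (l1_snd q) + ract (l1_snd p) (l1_fst q))"

context banach_bimodule
begin

interpretation L: bounded_bilinear lact by (rule bounded_bilinear_lact)
interpretation R: bounded_bilinear ract by (rule bounded_bilinear_ract)

lemmas modext_simps = modext_mult_def l1_sum_eq_iff l1_sum_ops
  mul_add_left mul_add_right mul_scaleC_left mul_scaleC_right
  L.add_left L.add_right R.add_left R.add_right
  lact_scaleC_left lact_scaleC_right ract_scaleC_left ract_scaleC_right
  scaleC_add_right add_ac

lemma modext_assoc:
  "modext_mult mul lact ract (modext_mult mul lact ract p q) r
    = modext_mult mul lact ract p (modext_mult mul lact ract q r)"
  by (simp add: modext_simps mul_assoc lact_lact ract_ract lact_ract)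

lemma modext_scaleC:
  "modext_mult mul lact ract (z *\<^sub>C p) q = z *\<^sub>C modext_mult mul lact ract p q"
  "modext_mult mul lact ract p (z *\<^sub>C q) = z *\<^sub>C modext_mult mul lact ract p q"
  by (simp_all add: modext_simps)

lemma bounded_bilinear_modext: "bounded_bilinear (modext_mult mul lact ract)"
proof
  fix p p' q q' :: "('a, 'x) l1_sum" and r :: real
  show "modext_mult mul lact ract (p + p') q
      = modext_mult mul lact ract p q + modext_mult mul lact ract p' q"
    "modext_mult mul lact ract p (q + q')
      = modext_mult mul lact ract p q + modext_mult mul lact ract p q'"
    by (simp_all add: modext_simps)
  show "modext_mult mul lact ract (r *\<^sub>R p) q = r *\<^sub>R modext_mult mul lact ract p q"
    "modext_mult mul lact ract p (r *\<^sub>R q) = r *\<^sub>R modext_mult mul lact ract p q"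
    by (simp_all add: scaleR_scaleC modext_scaleC)
  obtain K where K: "0 < K" "\<And>a x. norm (lact a x) \<le> norm a * norm x * K"
    using L.pos_bounded by blast
  obtain M where M: "0 < M" "\<And>x a. norm (ract x a) \<le> norm x * norm a * M"
    using R.pos_bounded by blast
  have "norm (modext_mult mul lact ract p q) \<le> norm p * norm q * (1 + K + M)" for p q
  proof -
    let ?a = "norm (l1_fst p)" and ?x = "norm (l1_snd p)"
    let ?b = "norm (l1_fst q)" and ?y = "norm (l1_snd q)"
    have "norm (modext_mult mul lact ract p q) \<le> ?a * ?b + (?a * ?y * K + ?x * ?b * M)"
      unfolding norm_l1_sum_def modext_mult_def l1_fst_L1 l1_snd_L1
      by (intro add_mono norm_mul_le norm_triangle_le K M)
    also have "\<dots> \<le> (?a + ?x) * (?b + ?y) * 1 + ((?a + ?x) * (?b + ?y) * K + (?a + ?x) * (?b + ?y) * M)"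
      using K(1) M(1)
      by (intro add_mono mult_right_mono) (auto simp: algebra_simps intro!: add_nonneg_nonneg)
    finally show ?thesis
      by (simp add: norm_l1_sum_def distrib_left add_ac)
  qed
  then show "\<exists>K. \<forall>p q. norm (modext_mult mul lact ract p q) \<le> norm p * norm q * K"
    by blast
qed

lemma modext_banach_algebra:
  assumes l: "\<And>a x. norm (lact a x) \<le> norm a * norm x"
    and r: "\<And>x a. norm (ract x a) \<le> norm x * norm a"
  shows "banach_algebra (modext_mult mul lact ract)"
proof
  fix p q :: "('a, 'x) l1_sum"
  let ?a = "norm (l1_fst p)" and ?x = "norm (l1_snd p)"
  let ?b = "norm (l1_fst q)" and ?y = "norm (l1_snd q)"
  have "norm (modext_mult mul lact ract p q) \<le> ?a * ?b + (?a * ?y + ?x * ?b)"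
    unfolding norm_l1_sum_def modext_mult_def l1_fst_L1 l1_snd_L1
    by (intro add_mono norm_mul_le norm_triangle_le l r)
  also have "\<dots> \<le> norm p * norm q"
    by (simp add: norm_l1_sum_def algebra_simps)
  finally show "norm (modext_mult mul lact ract p q) \<le> norm p * norm q" .
qed (use modext_assoc in \<open>simp_all add: modext_scaleC bounded_bilinear.add_left[OF bounded_bilinear_modext]
      bounded_bilinear.add_right[OF bounded_bilinear_modext]\<close>)

end

end

theory Submission
  imports Defs
begin

text \<open>Write \<open>E = A \<oplus>\<^sub>1 X\<close>. The projection \<open>E \<rightarrow> A\<close> and the embedding \<open>A \<rightarrow> E\<close> are both bounded
  homomorphisms, and both are surjective as far as characters can see, since every character of \<open>E\<close>
  kills the square-zero ideal \<open>0 \<oplus> X\<close>. For such a homomorphism \<open>h\<close>, the adjoint is injective on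
  characters and satisfies \<open>(\<psi> \<circ> h).a = (\<psi>.h(a)) \<circ> h\<close>, so that the second adjoint of \<open>h\<close> carries the
  functionals witnessing amenability of its domain to those for its codomain.\<close>

text \<open>The adjoint of \<open>h\<close>. \<open>Abs_cdual\<close> yields the intended functional
  when \<open>h\<close> is bounded and complex-linear, which is why the lemmas on it carry both
  hypotheses.\<close>

definition cdual_comp :: "('a::complex_normed_vector \<Rightarrow> 'b::complex_normed_vector) \<Rightarrow> 'b cdual \<Rightarrow> 'a cdual"
  where "cdual_comp h f = Abs_cdual (\<lambda>x. cdual_apply f (h x))"

lemma cdual_apply_zero [simp]: "cdual_apply 0 x = 0"
  by transfer simp

lemma cdual_comp_apply:
  assumes "bounded_linear h" and "\<And>z x. h (z *\<^sub>C x) = z *\<^sub>C h x"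
  shows "cdual_apply (cdual_comp h f) x = cdual_apply f (h x)"
proof -
  have "bounded_linear (\<lambda>x. cdual_apply f (h x))"
    by (intro bounded_linear_compose[OF bounded_linear_cdual_apply] assms)
  then show ?thesis
    by (simp add: cdual_comp_def Abs_cdual_inverse assms(2) cdual_apply_scaleC)
qed

lemma cdual_comp_scaleC:
  assumes "bounded_linear h" and "\<And>z x. h (z *\<^sub>C x) = z *\<^sub>C h x"
  shows "cdual_comp h (z *\<^sub>C f) = z *\<^sub>C cdual_comp h f"
  by (rule cdual_eqI) (simp add: cdual_comp_apply[OF assms] scaleC_cdual.rep_eq)

text \<open>With \<open>cdual_comp_scaleC\<close>, this makes the adjoint itself an admissible
  argument of \<open>cdual_comp\<close>, so that the second adjoint can be formed.\<close>

lemma bounded_linear_cdual_comp: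
  assumes h: "bounded_linear h" "\<And>z x. h (z *\<^sub>C x) = z *\<^sub>C h x"
  shows "bounded_linear (cdual_comp h)"
proof (rule bounded_linear_intro[where K = "onorm h"])
  note app = cdual_comp_apply[OF h]
  fix f g :: "'b cdual" and r :: real
  show "cdual_comp h (f + g) = cdual_comp h f + cdual_comp h g"
    by (rule cdual_eqI) (simp add: app plus_cdual.rep_eq)
  show "cdual_comp h (r *\<^sub>R f) = r *\<^sub>R cdual_comp h f"
    by (simp add: scaleR_scaleC cdual_comp_scaleC[OF h])
  have "cdual_apply (cdual_comp h f) = cdual_apply f \<circ> h"
    by (simp add: app fun_eq_iff)
  then show "norm (cdual_comp h f) \<le> norm f * onorm h"
    by (simp add: norm_cdual.rep_eq onorm_compose[OF bounded_linear_cdual_apply h(1)])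
qed

lemma Delta_weak_character_amenable_hom:
  fixes h :: "'a::complex_banach \<Rightarrow> 'b::complex_banach"
  assumes mul: "bounded_bilinear mul" "\<And>z a b. mul a (z *\<^sub>C b) = z *\<^sub>C mul a b"
    and mul': "bounded_bilinear mul'" "\<And>z a b. mul' a (z *\<^sub>C b) = z *\<^sub>C mul' a b"
    and h: "bounded_linear h" "\<And>z a. h (z *\<^sub>C a) = z *\<^sub>C h a"
    and hom: "\<And>a b. h (mul a b) = mul' (h a) (h b)"
    and sur: "\<And>b. \<exists>a. \<forall>\<psi> \<in> \<Delta> mul'. cdual_apply \<psi> b = cdual_apply \<psi> (h a)"
    and am: "Delta_weak_character_amenable mul"
  shows "Delta_weak_character_amenable mul'"
  unfolding Delta_weak_character_amenable_def Delta_weak_amenable_at_def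
proof
  note app = cdual_comp_apply[OF h]
  \<comment> \<open>Admitting 0 serves twice: it shows that characters pull back to nonzero
    functionals, and it covers the case \<open>\<phi> = 0\<close> of amenability.\<close>
  have inj: "\<psi> = \<phi>" if "cdual_comp h \<psi> = cdual_comp h \<phi>"
      "\<psi> \<in> \<Delta> mul' \<union> {0}" "\<phi> \<in> \<Delta> mul' \<union> {0}" for \<psi> \<phi>
  proof (rule cdual_eqI)
    fix b
    \<comment> \<open>In \<open>sur\<close> the element \<open>a\<close> depends on \<open>b\<close>
      only, so one \<open>a\<close> serves both functionals.\<close>
    obtain a where a: "\<forall>\<psi> \<in> \<Delta> mul'. cdual_apply \<psi> b = cdual_apply \<psi> (h a)"
      using sur by blast
    have "cdual_apply \<psi> b = cdual_apply (cdual_comp h \<psi>) a"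
      using a that(2) by (auto simp: app)
    also have "\<dots> = cdual_apply \<phi> b"
      using a that(3) by (auto simp: app that(1))
    finally show "cdual_apply \<psi> b = cdual_apply \<phi> b" .
  qed
  have comp0: "cdual_comp h 0 = 0"
    by (rule cdual_eqI) (simp add: app)
  have comp_char: "cdual_comp h \<psi> \<in> \<Delta> mul" if "\<psi> \<in> \<Delta> mul'" for \<psi>
    using that inj[of \<psi> 0] comp0 by (auto simp: characters_def app hom)
  fix \<phi> assume \<phi>: "\<phi> \<in> \<Delta> mul' \<union> {0}"
  then have "cdual_comp h \<phi> \<in> \<Delta> mul \<union> {0}"
    using comp_char comp0 by auto
  then obtain m where m0: "cdual_apply m (cdual_comp h \<phi>) = 0"
    and m: "\<And>a \<psi>. \<psi> \<in> \<Delta> mul \<Longrightarrow> \<psi> \<noteq> cdual_comp h \<phi> \<Longrightarrow>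
      cdual_apply m (dual_act mul \<psi> a) = cdual_apply \<psi> a"
    using am unfolding Delta_weak_character_amenable_def Delta_weak_amenable_at_def by blast
  \<comment> \<open>The second adjoint of \<open>h\<close> at \<open>m\<close>; \<open>m0\<close>
    then says that \<open>n\<close> vanishes at \<open>\<phi>\<close>.\<close>
  define n where "n = cdual_comp (cdual_comp h) m"
  have n: "cdual_apply n f = cdual_apply m (cdual_comp h f)" for f
    unfolding n_def
    by (rule cdual_comp_apply[OF bounded_linear_cdual_comp[OF h] cdual_comp_scaleC[OF h]])
  have "cdual_apply n (dual_act mul' \<psi> b) = cdual_apply \<psi> b"
    if \<psi>: "\<psi> \<in> \<Delta> mul'" "\<psi> \<noteq> \<phi>" for \<psi> b
  proof -
    obtain a where a: "cdual_apply \<psi> b = cdual_apply \<psi> (h a)"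
      using sur \<psi>(1) by blast
    \<comment> \<open>At x both sides equal \<psi>(b) \<psi>(h(x)): multiplicativity lets
      \<open>a\<close> stand in for \<open>b\<close> even if \<open>h a\<close> differs from
      \<open>b\<close>.\<close>
    have "cdual_comp h (dual_act mul' \<psi> b) = dual_act mul (cdual_comp h \<psi>) a"
      using \<psi>(1) a
      by (intro cdual_eqI)
         (simp add: app dual_act_apply[OF mul'] dual_act_apply[OF mul] hom characters_def)
    \<comment> \<open>The pullback of \<psi> must avoid the one functional excluded in
      \<open>m\<close>.\<close>
    moreover have "cdual_comp h \<psi> \<noteq> cdual_comp h \<phi>"
      using inj \<psi> \<phi> by blast
    ultimately show ?thesis
      using m[OF comp_char[OF \<psi>(1)]] by (simp add: n app a)
  qed
  then show "\<exists>m. cdual_apply m \<phi> = 0 \<and>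
      (\<forall>a. \<forall>\<psi>\<in>\<Delta> mul' - {\<phi>}. cdual_apply m (dual_act mul' \<psi> a) = cdual_apply \<psi> a)"
    using m0 n by (intro exI[of _ n]) auto
qed

lemma bounded_linear_l1_fst: "bounded_linear l1_fst"
  by (rule bounded_linear_intro[where K = 1]) (simp_all add: l1_sum_ops norm_l1_sum_def)

lemma bounded_linear_L1_0: "bounded_linear (\<lambda>a. L1 a 0)"
  by (rule bounded_linear_intro[where K = 1]) (simp_all add: l1_sum_ops norm_l1_sum_def)

context banach_bimodule
begin

text \<open>The element \<open>L1 0 x\<close> squares to zero, so the square of its value under
  \<psi> is 0, and the complex numbers have no nonzero nilpotents.\<close>

lemma character_modext:
  assumes "\<psi> \<in> \<Delta> (modext_mult mul lact ract)"
  shows "cdual_apply \<psi> p = cdual_apply \<psi> (L1 (l1_fst p) 0)"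
proof -
  interpret M: bounded_bilinear mul by (rule bounded_bilinear_mul)
  interpret L: bounded_bilinear lact by (rule bounded_bilinear_lact)
  interpret R: bounded_bilinear ract by (rule bounded_bilinear_ract)
  interpret \<psi>: bounded_linear "cdual_apply \<psi>" by (rule bounded_linear_cdual_apply)
  let ?x = "L1 0 (l1_snd p)"
  have "modext_mult mul lact ract ?x ?x = 0"
    by (simp add: modext_mult_def zero_l1_sum_def M.zero_left L.zero_left R.zero_right)
  then have "cdual_apply \<psi> ?x * cdual_apply \<psi> ?x = 0"
    using assms \<psi>.zero unfolding characters_def by (metis (mono_tags, lifting) mem_Collect_eq)
  moreover have "p = L1 (l1_fst p) 0 + ?x"
    by (simp add: plus_l1_sum_def)
  ultimately show ?thesis
    by (metis \<psi>.add add_0_right mult_eq_0_iff)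
qed

end

theorem theorem5p1:
  fixes mul :: "'a::complex_banach \<Rightarrow> 'a \<Rightarrow> 'a"
    and lact :: "'a \<Rightarrow> 'x::complex_banach \<Rightarrow> 'x"
    and ract :: "'x \<Rightarrow> 'a \<Rightarrow> 'x"
  assumes "banach_algebra mul"
    and "banach_bimodule mul lact ract"
  shows "Delta_weak_character_amenable (modext_mult mul lact ract)
    \<longleftrightarrow> Delta_weak_character_amenable mul"
proof -
  interpret banach_bimodule mul lact ract by (rule assms(2))
  interpret L: bounded_bilinear lact by (rule bounded_bilinear_lact)
  interpret R: bounded_bilinear ract by (rule bounded_bilinear_ract)
  \<comment> \<open>Needed for complex linearity of the embedding
    \<open>\<lambda>a. L1 a 0\<close>.\<close>
  have scaleC_0: "z *\<^sub>C (0::'x) = 0" for z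
    using norm_scaleC[of z "0::'x"] by simp
  show ?thesis
  proof
    assume "Delta_weak_character_amenable (modext_mult mul lact ract)"
    moreover have "\<exists>p::('a, 'x) l1_sum. \<forall>\<psi>\<in>\<Delta> mul. cdual_apply \<psi> b = cdual_apply \<psi> (l1_fst p)" for b
      by (rule exI[of _ "L1 b 0"]) simp
    ultimately show "Delta_weak_character_amenable mul"
      by (intro Delta_weak_character_amenable_hom[where h = l1_fst
            and mul = "modext_mult mul lact ract"])
         (simp_all add: bounded_bilinear_modext bounded_bilinear_mul
           mul_scaleC_right bounded_linear_l1_fst scaleC_l1_sum_def modext_mult_def
           lact_scaleC_right ract_scaleC_right scaleC_add_right)
  next
    assume "Delta_weak_character_amenable mul"
    \<comment> \<open>The embedding need not be onto; \<open>a = l1_fst p\<close> works because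
      characters ignore the second component.\<close>
    moreover have "\<exists>a. \<forall>\<psi>\<in>\<Delta> (modext_mult mul lact ract). cdual_apply \<psi> p = cdual_apply \<psi> (L1 a 0)" for p
      using character_modext by blast
    ultimately show "Delta_weak_character_amenable (modext_mult mul lact ract)"
      by (intro Delta_weak_character_amenable_hom[where h = "\<lambda>a. L1 a 0" and mul = mul])
         (simp_all add: bounded_bilinear_modext bounded_bilinear_mul
           mul_scaleC_right bounded_linear_L1_0 scaleC_l1_sum_def scaleC_0
           modext_mult_def lact_scaleC_right ract_scaleC_right scaleC_add_right
           L.zero_right R.zero_left)
  qed
qed

end
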